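(* Let $M>1$, $\mathcal R=[1/M,M]$ and, for a positive integer $s$, let $\phi_2(t,x)=\dfrac{2^s(x^{1/2^s}-1)}{2+(t+1)(x^{1/2^s}-1)}$. Put $$\rho=\frac{M^{1/2^s}+1}{M^{1/2^s}-1},\qquad L=\frac{2^s}{\frac{M^{1/2^s}+1}{M^{1/2^s}-1}-\frac{\rho}{2}-\frac{\rho^{-1}}{2}} .$$ Then $\rho>1$, $0<L<\infty$, and $|\phi_2(z,x)|\le L$ for all $x\in\mathcal R$ and all $z=\frac{\rho}{2}e^{i\theta}+\frac{\rho^{-1}}{2}e^{-i\theta}$, $\theta\in[0,2\pi]$. Moreover, choosing $s=N$, for every $\epsilon>0$ one can choose a number of points $N=O\big(\log\log(M)+\sqrt{\log(M)+\log(1/\epsilon)}\big)$ such that $$\operatorname{hyp}\log(-\epsilon)\subseteq\hat H_{\phi_2,N}\subseteq\operatorname{hyp}\log(\epsilon),$$ where, with $\{t_k\}_{k\in[N]}$, $\{w_k\}_{k\in[N]}$ the nodes and weights of $N$-point Gaussian quadrature on $[-1,1]$, $\hat H_{\phi_2,N}$ is the set of $(x,\nu)\in\mathcal R\times\mathbb R$ for which there exist $r_i$ ($i\in[s]$) and $v_k,\gamma_{1k},\gamma_{2k}$ ($k\in[N]$) in $\mathbb R$ with $$\sum_{k\in[N]}w_kv_k\ge\nu,\qquad r_i\ge0\ \ \forall i\in[s],$$ $$(2r_1,x-1,x+1)\in\mathcal L_3,\qquad (2r_{i+1},r_i-1,r_i+1)\in\mathcal L_3\ \ \forall i\in[s-1],$$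 $$\gamma_{1k}=2^s-(t_k+1)v_k\ge0,\quad \gamma_{2k}=r_s-1-2^{1-s}v_k\ge0,\quad \big(v_k\sqrt{2^{3-s}(t_k+1)},\,\gamma_{1k}-\gamma_{2k},\,\gamma_{1k}+\gamma_{2k}\big)\in\mathcal L_3\ \ \forall k\in[N].$$ In particular $\hat H_{\phi_2,N}$ is represented with $O(\log\log(M)+\sqrt{\log(M)+\log(1/\epsilon)})$ variables and second-order conic constraints.
   Context: $[N]=\{1,\dots,N\}$; $\mathcal L_3=\{y\in\mathbb R^3:y_3\ge\sqrt{y_1^2+y_2^2}\}$; for $\alpha\in\mathbb R$, $\operatorname{hyp}\log(\alpha)=\{(x,\nu)\in\mathcal R\times\mathbb R:\log(x)\ge\nu-\alpha\}$. Gaussian quadrature is Gauss–Legendre quadrature. $O(\cdot)$ is the usual asymptotic notation, describing growth in $M$ and $1/\epsilon$. *)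

theory Defs
  imports
    "HOL-Analysis.Analysis"
    "HOL-Computational_Algebra.Polynomial"
    "HOL-Library.Landau_Symbols"
begin

text \<open>Legendre polynomials are given by the Rodrigues formula. The nodes are the roots of
  the \<open>N\<close>-th Legendre polynomial in increasing order and the weights are the integrals of the
  associated Lagrange basis polynomials; both are indexed by \<open>k \<in> {1..N}\<close>.\<close>

definition legendre :: "nat \<Rightarrow> real poly" where
  "legendre n = smult (1 / (2 ^ n * fact n)) ((pderiv ^^ n) ([:-1, 0, 1:] ^ n))"

definition gauss_node :: "nat \<Rightarrow> nat \<Rightarrow> real" where
  "gauss_node N k = sorted_list_of_set {t. poly (legendre N) t = 0} ! (k - 1)"

definition gauss_weight :: "nat \<Rightarrow> nat \<Rightarrow> real" where
  "gauss_weight N k = integral {-1..1}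
     (\<lambda>t. \<Prod>j\<in>{1..N} - {k}. (t - gauss_node N j) / (gauss_node N k - gauss_node N j))"

definition phi2 :: "nat \<Rightarrow> complex \<Rightarrow> real \<Rightarrow> complex" where
  "phi2 s z x = 2 ^ s * (of_real (x powr (1 / 2 ^ s)) - 1)
                / (2 + (z + 1) * (of_real (x powr (1 / 2 ^ s)) - 1))"

definition rho :: "real \<Rightarrow> nat \<Rightarrow> real" where
  "rho M s = (M powr (1 / 2 ^ s) + 1) / (M powr (1 / 2 ^ s) - 1)"

text \<open>The quotient is taken in the extended reals, where \<open>2 ^ s / 0 = \<infinity>\<close>, so that finiteness
  of the bound is a genuine assertion about its denominator.\<close>

definition Lbound :: "real \<Rightarrow> nat \<Rightarrow> ereal" where
  "Lbound M s = ereal (2 ^ s) /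
     ereal ((M powr (1 / 2 ^ s) + 1) / (M powr (1 / 2 ^ s) - 1)
            - rho M s / 2 - inverse (rho M s) / 2)"

definition hyp_log :: "real \<Rightarrow> real \<Rightarrow> (real \<times> real) set" where
  "hyp_log M \<alpha> = {(x, \<nu>). x \<in> {1 / M..M} \<and> ln x \<ge> \<nu> - \<alpha>}"

definition lorentz3 :: "(real \<times> real \<times> real) set" where
  "lorentz3 = {(y1, y2, y3). y3 \<ge> sqrt (y1\<^sup>2 + y2\<^sup>2)}"

definition Hhat :: "real \<Rightarrow> nat \<Rightarrow> nat \<Rightarrow> (real \<times> real) set" where
  "Hhat M s N = {(x, \<nu>). x \<in> {1 / M..M} \<and>
     (\<exists>r v \<gamma>1 \<gamma>2 :: nat \<Rightarrow> real.
        (\<Sum>k\<in>{1..N}. gauss_weight N k * v k) \<ge> \<nu> \<and>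
        (\<forall>i\<in>{1..s}. r i \<ge> 0) \<and>
        (2 * r 1, x - 1, x + 1) \<in> lorentz3 \<and>
        (\<forall>i\<in>{1..s - 1}. (2 * r (i + 1), r i - 1, r i + 1) \<in> lorentz3) \<and>
        (\<forall>k\<in>{1..N}.
           \<gamma>1 k = 2 ^ s - (gauss_node N k + 1) * v k \<and> \<gamma>1 k \<ge> 0 \<and>
           \<gamma>2 k = r s - 1 - 2 powi (1 - int s) * v k \<and> \<gamma>2 k \<ge> 0 \<and>
           (v k * sqrt (2 powi (3 - int s) * (gauss_node N k + 1)), \<gamma>1 k - \<gamma>2 k, \<gamma>1 k + \<gamma>2 k)
             \<in> lorentz3))}"

text \<open>Second-order cone systems as syntactic objects, so that variables and constraints can be
  counted. An affine form is a list of variables with coefficients together with a constant.\<close>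

type_synonym 'v affine_form = "('v \<times> real) list \<times> real"

definition eval_form :: "('v \<Rightarrow> real) \<Rightarrow> 'v affine_form \<Rightarrow> real" where
  "eval_form y a = (\<Sum>(i, c)\<leftarrow>fst a. c * y i) + snd a"

definition form_vars :: "'v affine_form \<Rightarrow> 'v set" where
  "form_vars a = fst ` set (fst a)"

datatype 'v soc_constraint =
    EqZero "'v affine_form"
  | NonNeg "'v affine_form"
  | Cone "'v affine_form" "'v affine_form" "'v affine_form"

primrec satisfies :: "('v \<Rightarrow> real) \<Rightarrow> 'v soc_constraint \<Rightarrow> bool" where
  "satisfies y (EqZero a) \<longleftrightarrow> eval_form y a = 0"
| "satisfies y (NonNeg a) \<longleftrightarrow> eval_form y a \<ge> 0"
| "satisfies y (Cone a b c) \<longleftrightarrow> (eval_form y a, eval_form y b, eval_form y c) \<in> lorentz3"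

primrec constraint_vars :: "'v soc_constraint \<Rightarrow> 'v set" where
  "constraint_vars (EqZero a) = form_vars a"
| "constraint_vars (NonNeg a) = form_vars a"
| "constraint_vars (Cone a b c) = form_vars a \<union> form_vars b \<union> form_vars c"

definition num_variables :: "'v soc_constraint list \<Rightarrow> nat" where
  "num_variables cs = card (\<Union> (constraint_vars ` set cs))"

definition num_constraints :: "'v soc_constraint list \<Rightarrow> nat" where
  "num_constraints cs = length cs"

text \<open>\<open>cs\<close> represents \<open>S\<close> if \<open>S\<close> is the projection of its solution set onto the variables
  \<open>p\<close> and \<open>q\<close>.\<close>

definition soc_represents ::
    "'v soc_constraint list \<Rightarrow> 'v \<Rightarrow> 'v \<Rightarrow> (real \<times> real) set \<Rightarrow> bool" where
  "soc_represents cs p q S \<longleftrightarrow> S = {(y p, y q) | y. \<forall>c\<in>set cs. satisfies y c}"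

datatype hvar = VarX | VarNu | VarR nat | VarV nat | VarG1 nat | VarG2 nat

text \<open>The constraints of \<open>Hhat M s N\<close>, the bounds \<open>1 / M \<le> x \<le> M\<close> included.\<close>

definition Hhat_system :: "real \<Rightarrow> nat \<Rightarrow> nat \<Rightarrow> hvar soc_constraint list" where
  "Hhat_system M s N =
     [NonNeg ([(VarX, 1)], - (1 / M)),
      NonNeg ([(VarX, -1)], M),
      NonNeg (map (\<lambda>k. (VarV k, gauss_weight N k)) [1..<Suc N] @ [(VarNu, -1)], 0)] @
     map (\<lambda>i. NonNeg ([(VarR i, 1)], 0)) [1..<Suc s] @
     [Cone ([(VarR 1, 2)], 0) ([(VarX, 1)], -1) ([(VarX, 1)], 1)] @
     map (\<lambda>i. Cone ([(VarR (i + 1), 2)], 0) ([(VarR i, 1)], -1) ([(VarR i, 1)], 1)) [1..<s] @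
     concat (map (\<lambda>k.
       [EqZero ([(VarG1 k, 1), (VarV k, gauss_node N k + 1)], - (2 ^ s)),
        NonNeg ([(VarG1 k, 1)], 0),
        EqZero ([(VarG2 k, 1), (VarR s, -1), (VarV k, 2 powi (1 - int s))], 1),
        NonNeg ([(VarG2 k, 1)], 0),
        Cone ([(VarV k, sqrt (2 powi (3 - int s) * (gauss_node N k + 1)))], 0)
             ([(VarG1 k, 1), (VarG2 k, -1)], 0)
             ([(VarG1 k, 1), (VarG2 k, 1)], 0)]) [1..<Suc N])"

text \<open>The regime of the asymptotic bounds, on pairs \<open>(M, \<epsilon>)\<close>: at least one of \<open>M\<close> and
  \<open>1 / \<epsilon>\<close> tends to infinity, while \<open>M \<ge> M0\<close> and \<open>0 < \<epsilon> \<le> e0\<close>. It covers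
  both growing jointly as well as one growing with the other one fixed.\<close>

definition growth :: "real \<Rightarrow> real \<Rightarrow> (real \<times> real) filter" where
  "growth M0 e0 = inf (filtercomap (\<lambda>(M, \<epsilon>). max M (1 / \<epsilon>)) at_top)
                      (principal ({M0..} \<times> {0<..e0}))"

definition rate :: "real \<times> real \<Rightarrow> real" where
  "rate = (\<lambda>(M, \<epsilon>). ln (ln M) + sqrt (ln M + ln (1 / \<epsilon>)))"

end

theory Submission
  imports Defs
begin

text \<open>Put \<open>y = x powr (1 / 2 ^ s)\<close> and \<open>b = (y - 1) / (y + 1)\<close>. Since the Gauss weights are
  nonnegative and the integrand is increasing in \<open>y\<close>, eliminating the auxiliary variables
  turns \<open>Hhat M s N\<close> into the hypograph of the \<open>N\<close>-point Gauss approximation of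
  \<open>ln x = integral {-1..1} (\<lambda>t. 2 ^ s * b / (1 + b * t))\<close>. Truncating the geometric series of
  this integrand after \<open>2 * N\<close> terms gives a polynomial that the quadrature integrates exactly,
  so the error is at most \<open>4 * 2 ^ s * \<bar>b\<bar> ^ (2 * N + 1) / (1 - \<bar>b\<bar>)\<close>, where
  \<open>\<bar>b\<bar> \<le> \<bar>ln x\<bar> / 2 ^ s\<close>.\<close>

section \<open>Gauss--Legendre quadrature\<close>

definition poly_integral :: "real poly \<Rightarrow> real" where
  "poly_integral p = integral {-1..1} (poly p)"

lemma poly_integrable [simp]: "(poly p :: real \<Rightarrow> real) integrable_on {a..b}"
  by (rule integrable_continuous_interval) (intro continuous_intros)

lemma poly_integral_add: "poly_integral (p + q) = poly_integral p + poly_integral q"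
proof -
  have "poly (p + q) = (\<lambda>t. poly p t + poly q t)" by auto
  then show ?thesis by (simp add: poly_integral_def integral_add)
qed

lemma poly_integral_smult: "poly_integral (smult c p) = c * poly_integral p"
proof -
  have "poly (smult c p) = (\<lambda>t. c * poly p t)" by auto
  then show ?thesis by (simp add: poly_integral_def)
qed

lemma poly_integral_0 [simp]: "poly_integral 0 = 0"
  using poly_integral_smult[of 0 0] by simp

lemma poly_integral_sum: "poly_integral (\<Sum>x\<in>A. f x) = (\<Sum>x\<in>A. poly_integral (f x))"
proof (induction A rule: infinite_finite_induct)
  case (insert x F)
  then show ?case by (simp add: poly_integral_add)
qed simp_all

lemma poly_integral_pderiv: "poly_integral (pderiv p) = poly p 1 - poly p (-1)"
proof -
  have "(poly (pderiv p) has_integral poly p 1 - poly p (-1)) {-1..1}"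
    by (rule fundamental_theorem_of_calculus)
       (auto intro!: has_vector_derivative_at_within poly_DERIV
             simp: has_real_derivative_iff_has_vector_derivative[symmetric]
             intro: has_field_derivative_at_within)
  then show ?thesis
    by (simp add: poly_integral_def integral_unique)
qed

lemma poly_integral_by_parts:
  assumes "poly q 1 = 0" "poly q (-1) = 0"
  shows "poly_integral (p * pderiv q) = - poly_integral (pderiv p * q)"
proof -
  have "poly_integral (pderiv (p * q)) = 0"
    using assms by (simp add: poly_integral_pderiv)
  then show ?thesis
    by (simp add: pderiv_mult poly_integral_add mult.commute)
qed

section \<open>Rodrigues' formula and orthogonality\<close>

lemma power_dvd_pderiv_power:
  fixes p q :: "real poly"
  assumes "p ^ Suc n dvd q"
  shows "p ^ n dvd pderiv q"
proof -
  obtain r where "q = p ^ Suc n * r" using assms by (elim dvdE)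
  then show ?thesis
    by (auto simp: pderiv_mult pderiv_power_Suc algebra_simps simp del: power_Suc
        intro!: dvd_add dvd_mult dvd_smult) (simp_all add: power_Suc2 del: power_Suc)
qed

lemma power_dvd_pderiv_funpow:
  fixes p :: "real poly"
  assumes "j \<le> n"
  shows "p ^ (n - j) dvd (pderiv ^^ j) (p ^ n)"
  using assms
proof (induction j)
  case (Suc j)
  then have "p ^ Suc (n - Suc j) dvd (pderiv ^^ j) (p ^ n)"
    by (simp add: Suc_diff_Suc del: power_Suc)
  then show ?case
    by (simp add: power_dvd_pderiv_power)
qed simp

text \<open>Each derivative removes at most one factor \<open>[:-1, 0, 1:]\<close>, so fewer than
  \<open>n\<close> of them leave one standing, and it vanishes at both ends. These zeros kill the
  boundary terms in integration by parts and feed Rolle's theorem.\<close>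

lemma rodrigues_deriv_endpoints:
  assumes "j < n"
  shows "poly ((pderiv ^^ j) ([:-1, 0, 1:] ^ n)) 1 = (0::real)"
    and "poly ((pderiv ^^ j) ([:-1, 0, 1:] ^ n)) (-1) = (0::real)"
proof -
  obtain r where "(pderiv ^^ j) ([:-1, 0, 1:] ^ n) = [:-1, 0, 1:] ^ (n - j) * (r :: real poly)"
    using power_dvd_pderiv_funpow[of j n "[:-1, 0, 1:]"] assms by (auto elim: dvdE)
  with assms show "poly ((pderiv ^^ j) ([:-1, 0, 1:] ^ n)) 1 = (0::real)"
    and "poly ((pderiv ^^ j) ([:-1, 0, 1:] ^ n)) (-1) = (0::real)"
    by simp_all
qed

lemma degree_pderiv_funpow: "degree ((pderiv ^^ j) (p :: real poly)) = degree p - j"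
  by (induction j) (simp_all add: degree_pderiv)

text \<open>Repeated integration by parts moves the \<open>n\<close> derivatives of Rodrigues'
  formula onto \<open>p\<close>, whose degree is too small to survive them.\<close>

lemma legendre_orthogonal:
  assumes "degree p < n"
  shows "poly_integral (p * legendre n) = 0"
proof -
  let ?q = "[:-1, 0, 1:] ^ n :: real poly"
  \<comment> \<open>The exponent \<open>n\<close> stays fixed while \<open>j\<close> and
    \<open>p\<close> vary, because one integration by parts lowers \<open>j\<close> and
    differentiates \<open>p\<close>.\<close>
  have "poly_integral (p * (pderiv ^^ j) ?q) = 0" if "degree p < j" "j \<le> n" for j p
    using that
  proof (induction j arbitrary: p)
    case (Suc j)
    have "poly_integral (p * (pderiv ^^ Suc j) ?q) = - poly_integral (pderiv p * (pderiv ^^ j) ?q)"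
      using poly_integral_by_parts[OF rodrigues_deriv_endpoints, of j n p] Suc.prems by simp
    also have "\<dots> = 0"
    \<comment> \<open>Constants are treated apart: the derivative of a constant still has degree 0,
      which is not below \<open>j\<close> when \<open>j = 0\<close>.\<close>
    proof (cases "degree p = 0")
      case True
      then have "pderiv p = 0" by (simp add: pderiv_eq_0_iff)
      then show ?thesis by simp
    next
      case False
      then show ?thesis using Suc by (simp add: degree_pderiv)
    qed
    finally show ?case .
  qed simp
  then show ?thesis
    using assms by (simp add: legendre_def poly_integral_smult)
qed

section \<open>Degree and zeros of the Legendre polynomials\<close>

lemma degree_legendre: "degree (legendre n) = n"
proof -
  have "degree ([:-1, 0, 1:] ^ n :: real poly) = 2 * n"
    by (simp add: degree_power_eq)
  then show ?thesis
    by (simp add: legendre_def degree_pderiv_funpow)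
qed

text \<open>Rolle's theorem is applied between consecutive elements of \<open>A\<close>; the zeros
  obtained interlace with \<open>A\<close>, hence are distinct and lie in the open interval.\<close>

lemma Rolle_card:
  fixes p :: "real poly"
  assumes "finite A" "card A = Suc m" "\<And>x. x \<in> A \<Longrightarrow> poly p x = 0" "A \<subseteq> {a..b}"
  shows "\<exists>B. finite B \<and> card B = m \<and> B \<subseteq> {a<..<b} \<and> (\<forall>x\<in>B. poly (pderiv p) x = 0)"
proof -
  define xs where "xs = sorted_list_of_set A"
  have xs: "sorted_wrt (<) xs" "set xs = A" "length xs = Suc m"
    using assms by (simp_all add: xs_def)
  have "\<exists>z. xs ! i < z \<and> z < xs ! Suc i \<and> poly (pderiv p) z = 0" if "i < m" for i
  proof -
    have "xs ! i < xs ! Suc i" "poly p (xs ! i) = 0" "poly p (xs ! Suc i) = 0"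
      using that xs assms(3) by (auto intro: sorted_wrt_nth_less)
    then show ?thesis
      using poly_MVT[of "xs ! i" "xs ! Suc i" p] by auto
  qed
  then obtain z where z: "\<And>i. i < m \<Longrightarrow> xs ! i < z i"
      "\<And>i. i < m \<Longrightarrow> z i < xs ! Suc i" "\<And>i. i < m \<Longrightarrow> poly (pderiv p) (z i) = 0"
    by metis
  have less: "z i < z j" if "i < j" "j < m" for i j
  proof -
    have "xs ! Suc i \<le> xs ! j"
      using that xs by (cases "Suc i = j") (auto intro!: less_imp_le sorted_wrt_nth_less[of "(<)"])
    then show ?thesis
      using z(2)[of i] z(1)[of j] that by linarith
  qed
  have inj: "inj_on z {..<m}"
    by (rule linorder_inj_onI) (auto dest: less)
  have "z i \<in> {a<..<b}" if "i < m" for i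
  proof -
    have "xs ! i \<in> {a..b}" "xs ! Suc i \<in> {a..b}"
      using that xs assms(4) by (auto simp flip: xs(2) simp: subset_iff)
    then show ?thesis using z(1)[of i] z(2)[of i] that by auto
  qed
  with z(3) inj show ?thesis
    by (intro exI[of _ "z ` {..<m}"]) (auto simp: card_image)
qed

text \<open>As long as \<open>j < n\<close>, the endpoints join the \<open>j\<close> interior zeros,
  and Rolle's theorem turns these \<open>j + 2\<close> zeros into \<open>j + 1\<close> interior
  zeros of the next derivative.\<close>

lemma rodrigues_deriv_roots:
  assumes "j \<le> n"
  shows "\<exists>B. finite B \<and> card B = j \<and> B \<subseteq> {-1<..<1} \<and>
           (\<forall>x\<in>B. poly ((pderiv ^^ j) ([:-1, 0, 1:] ^ n)) x = (0::real))"
  using assms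
proof (induction j)
  case (Suc j)
  then obtain B :: "real set" where B: "finite B" "card B = j" "B \<subseteq> {-1<..<1}"
      "\<forall>x\<in>B. poly ((pderiv ^^ j) ([:-1, 0, 1:] ^ n)) x = 0"
    by auto
  have "1 \<notin> B" "-1 \<notin> insert 1 B"
    using B(3) by auto
  then have "card (insert (-1) (insert 1 B)) = Suc (Suc j)"
    using B by simp
  moreover have "insert (-1) (insert 1 B) \<subseteq> {-1..1}"
    using B(3) by auto
  moreover have "poly ((pderiv ^^ j) ([:-1, 0, 1:] ^ n)) x = 0" if "x \<in> insert (-1) (insert 1 B)" for x
    using that B(4) rodrigues_deriv_endpoints[of j n] Suc.prems by auto
  ultimately show ?case
    using Rolle_card[of "insert (-1) (insert 1 B)" "Suc j" "(pderiv ^^ j) ([:-1, 0, 1:] ^ n)" "-1" 1]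
      B(1) by simp
next
  case 0
  show ?case by (intro exI[of _ "{}"]) simp
qed

text \<open>Rolle's theorem supplies \<open>n\<close> zeros in the open interval, and the degree
  allows no others.\<close>

lemma legendre_roots:
  assumes "n \<ge> 1"
  shows "finite {t. poly (legendre n) t = 0}" "card {t. poly (legendre n) t = 0} = n"
    and "{t. poly (legendre n) t = 0} \<subseteq> {-1<..<1}"
proof -
  let ?R = "{t. poly (legendre n) t = 0}"
  have nz: "legendre n \<noteq> 0"
    using degree_legendre[of n] assms by force
  show fin: "finite ?R"
    using nz by (simp add: poly_roots_finite)
  obtain B where B: "finite B" "card B = n" "B \<subseteq> {-1<..<1}" "B \<subseteq> ?R"
    using rodrigues_deriv_roots[of n n] by (auto simp: legendre_def)
  have "card ?R \<le> n"
    using card_poly_roots_bound[OF nz] by (simp add: degree_legendre)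
  then have "B = ?R"
    using B fin by (metis card_seteq)
  with B show "card ?R = n" "?R \<subseteq> {-1<..<1}" by auto
qed

lemma gauss_node_bij:
  assumes "N \<ge> 1"
  shows "bij_betw (gauss_node N) {1..N} {t. poly (legendre N) t = 0}"
proof -
  let ?R = "{t. poly (legendre N) t = 0}"
  have "bij_betw ((!) (sorted_list_of_set ?R)) {..<N} ?R"
    using legendre_roots[OF assms] by (intro bij_betw_nth) simp_all
  moreover have "bij_betw (\<lambda>k. k - 1) {1..N} {..<N}"
    by (rule bij_betw_byWitness[of _ Suc]) auto
  ultimately have "bij_betw ((!) (sorted_list_of_set ?R) \<circ> (\<lambda>k. k - 1)) {1..N} ?R"
    by (rule bij_betw_trans[rotated])
  then show ?thesis
    by (simp add: gauss_node_def[abs_def] comp_def)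
qed

lemma gauss_node_bounds:
  assumes "k \<in> {1..N}"
  shows "-1 < gauss_node N k" "gauss_node N k < 1"
proof -
  have "N \<ge> 1" using assms by auto
  then have "gauss_node N k \<in> {-1<..<1}"
    using bij_betwE[OF gauss_node_bij] legendre_roots(3) assms by blast
  then show "-1 < gauss_node N k" "gauss_node N k < 1" by auto
qed

lemma poly_legendre_gauss_node:
  assumes "k \<in> {1..N}"
  shows "poly (legendre N) (gauss_node N k) = 0"
proof -
  have "N \<ge> 1" using assms by auto
  then show ?thesis
    using bij_betwE[OF gauss_node_bij] assms by blast
qed

lemma inj_on_gauss_node: "inj_on (gauss_node N) {1..N}"
  using gauss_node_bij[of N] by (cases "N \<ge> 1") (auto simp: bij_betw_def)

section \<open>Lagrange interpolation at the nodes, exactness and error of the quadrature\<close>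

definition lagrange_basis :: "nat \<Rightarrow> nat \<Rightarrow> real poly" where
  "lagrange_basis N k = (\<Prod>j\<in>{1..N} - {k}.
     smult (1 / (gauss_node N k - gauss_node N j)) [:- gauss_node N j, 1:])"

lemma gauss_weight_eq: "gauss_weight N k = poly_integral (lagrange_basis N k)"
proof -
  have "poly (lagrange_basis N k) =
      (\<lambda>t. \<Prod>j\<in>{1..N} - {k}. (t - gauss_node N j) / (gauss_node N k - gauss_node N j))"
    by (auto simp: lagrange_basis_def poly_prod diff_divide_distrib intro!: prod.cong)
  then show ?thesis
    by (simp add: gauss_weight_def poly_integral_def)
qed

lemma degree_lagrange_basis:
  assumes "k \<in> {1..N}"
  shows "degree (lagrange_basis N k) < N"
proof -
  have "degree (lagrange_basis N k) \<le>
      (\<Sum>j\<in>{1..N} - {k}. degree (smult (1 / (gauss_node N k - gauss_node N j)) [:- gauss_node N j, 1:]))"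
    unfolding lagrange_basis_def by (rule degree_prod_sum_le[unfolded comp_def]) simp
  also have "\<dots> \<le> (\<Sum>j\<in>{1..N} - {k}. 1)"
    by (intro sum_mono) simp
  also have "\<dots> < N"
    using assms by simp
  finally show ?thesis .
qed

lemma poly_lagrange_basis:
  assumes "k \<in> {1..N}" "j \<in> {1..N}"
  shows "poly (lagrange_basis N k) (gauss_node N j) = (if j = k then 1 else 0)"
proof (cases "j = k")
  case True
  have "gauss_node N k \<noteq> gauss_node N i" if "i \<in> {1..N} - {k}" for i
    using inj_on_eq_iff[OF inj_on_gauss_node, of k N i] assms(1) that by auto
  then have "(\<Prod>i\<in>{1..N} - {k}. poly (smult (1 / (gauss_node N k - gauss_node N i))
      [:- gauss_node N i, 1:]) (gauss_node N k)) = 1"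
    by (intro prod.neutral ballI) (simp only: poly_smult poly_pCons poly_0, simp)
  then show ?thesis
    using True by (simp only: lagrange_basis_def poly_prod) simp
next
  case False
  then have "poly (lagrange_basis N k) (gauss_node N j) = 0"
    unfolding lagrange_basis_def poly_prod
    using assms by (intro prod_zero bexI[of _ j]) simp_all
  then show ?thesis using False by simp
qed

text \<open>Both sides have degree below \<open>N\<close> and agree at \<open>N\<close> distinct
  nodes.\<close>

lemma lagrange_interpolation:
  assumes "degree p < N"
  shows "p = (\<Sum>k\<in>{1..N}. smult (poly p (gauss_node N k)) (lagrange_basis N k))"
    (is "p = ?r")
proof (rule poly_eqI_degree[where A = "gauss_node N ` {1..N}"])
  show "degree p < card (gauss_node N ` {1..N})"
    using assms by (subst card_image[OF inj_on_gauss_node]) simp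
  have "degree ?r \<le> N - 1"
  proof (rule degree_sum_le)
    fix k assume "k \<in> {1..N}"
    then show "degree (smult (poly p (gauss_node N k)) (lagrange_basis N k)) \<le> N - 1"
      using degree_lagrange_basis[of k N] degree_smult_le[of "poly p (gauss_node N k)" "lagrange_basis N k"]
      by linarith
  qed simp
  then show "degree ?r < card (gauss_node N ` {1..N})"
    using assms by (subst card_image[OF inj_on_gauss_node]) simp
  fix x assume "x \<in> gauss_node N ` {1..N}"
  then obtain j where j: "j \<in> {1..N}" "x = gauss_node N j" by auto
  have "poly ?r x = (\<Sum>k\<in>{1..N}. if j = k then poly p (gauss_node N k) else 0)"
    unfolding j(2) poly_sum by (rule sum.cong) (use j poly_lagrange_basis in auto)
  then show "poly p x = poly ?r x"
    using j by simp
qed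

text \<open>Division by \<open>legendre N\<close> leaves quotient and remainder of degree below
  \<open>N\<close>. The multiple of \<open>legendre N\<close> has integral 0 by orthogonality and
  vanishes at the nodes, so only the remainder counts, and it equals its interpolant.\<close>

lemma gauss_quadrature_exact:
  assumes "degree p < 2 * N"
  shows "poly_integral p = (\<Sum>k\<in>{1..N}. gauss_weight N k * poly p (gauss_node N k))"
proof -
  have N: "N \<ge> 1" using assms by auto
  then have nz: "legendre N \<noteq> 0"
    using degree_legendre[of N] by force
  define q r where "q = p div legendre N" and "r = p mod legendre N"
  have p: "p = q * legendre N + r"
    by (simp add: q_def r_def)
  have r: "degree r < N"
    using degree_mod_less'[of "legendre N" p] nz N degree_legendre[of N]
    by (cases "r = 0") (auto simp: r_def)
  have "degree q < N"
  proof -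
    have "degree (q * legendre N) \<le> max (degree p) (degree r)"
      using p degree_diff_le_max[of p r] by simp
    then have "degree (q * legendre N) < 2 * N"
      using assms r by simp
    then show ?thesis
      using N nz by (cases "q = 0") (simp_all add: degree_mult_eq degree_legendre)
  qed
  then have "poly_integral p = poly_integral r"
    by (subst p) (simp add: poly_integral_add legendre_orthogonal)
  also have "\<dots> = (\<Sum>k\<in>{1..N}. gauss_weight N k * poly r (gauss_node N k))"
    by (subst lagrange_interpolation[OF r]) (simp add: poly_integral_sum poly_integral_smult gauss_weight_eq mult.commute)
  also have "\<dots> = (\<Sum>k\<in>{1..N}. gauss_weight N k * poly p (gauss_node N k))"
  proof (rule sum.cong)
    fix k assume "k \<in> {1..N}"
    then have "poly p (gauss_node N k) = poly r (gauss_node N k)"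
      unfolding p poly_add poly_mult by (simp add: poly_legendre_gauss_node)
    then show "gauss_weight N k * poly r (gauss_node N k) = gauss_weight N k * poly p (gauss_node N k)"
      by simp
  qed simp
  finally show ?thesis .
qed

text \<open>The square of the Lagrange basis polynomial has degree below \<open>2 * N\<close>, so
  the quadrature is exact on it and returns the weight itself.\<close>

lemma gauss_weight_nonneg:
  assumes "k \<in> {1..N}"
  shows "gauss_weight N k \<ge> 0"
proof -
  have "degree (lagrange_basis N k * lagrange_basis N k) < 2 * N"
    using degree_lagrange_basis[OF assms] degree_mult_le[of "lagrange_basis N k" "lagrange_basis N k"]
    by linarith
  then have "poly_integral (lagrange_basis N k * lagrange_basis N k) =
      (\<Sum>j\<in>{1..N}. if j = k then gauss_weight N j else 0)"
    unfolding gauss_quadrature_exact[OF \<open>degree _ < 2 * N\<close>]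
    using assms by (intro sum.cong) (simp_all add: poly_lagrange_basis)
  also have "\<dots> = gauss_weight N k"
    using assms by simp
  finally have "gauss_weight N k = poly_integral (lagrange_basis N k * lagrange_basis N k)" ..
  also have "\<dots> \<ge> 0"
    unfolding poly_integral_def by (rule integral_nonneg) simp_all
  finally show ?thesis .
qed

lemma sum_gauss_weight:
  assumes "N \<ge> 1"
  shows "(\<Sum>k\<in>{1..N}. gauss_weight N k) = 2"
proof -
  have "poly (1 :: real poly) = (\<lambda>t. 1)" by auto
  then have "poly_integral 1 = 2" by (simp add: poly_integral_def)
  then show ?thesis
    using gauss_quadrature_exact[of 1 N] assms by simp
qed

text \<open>By exactness \<open>p\<close> cancels. The deviation \<open>f - p\<close> costs
  \<open>2 * d\<close> in the integral, from the length of the interval, and \<open>2 * d\<close> in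
  the sum, from the total weight of nonnegative weights.\<close>

lemma gauss_quadrature_error:
  assumes N: "N \<ge> 1" and p: "degree p < 2 * N" and f: "f integrable_on {-1..1}"
    and le: "\<And>t. t \<in> {-1..1} \<Longrightarrow> \<bar>f t - poly p t\<bar> \<le> d"
  shows "\<bar>integral {-1..1} f - (\<Sum>k\<in>{1..N}. gauss_weight N k * f (gauss_node N k))\<bar> \<le> 4 * d"
proof -
  have "\<bar>integral {-1..1} (\<lambda>t. f t - poly p t)\<bar> \<le> integral {-1..1} (\<lambda>t::real. d)"
    using integral_norm_bound_integral[OF integrable_diff[OF f poly_integrable] integrable_const_ivl, of p d] le
    by simp
  then have 1: "\<bar>integral {-1..1} f - poly_integral p\<bar> \<le> 2 * d"
    using f by (simp add: integral_diff poly_integral_def)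
  have "\<bar>\<Sum>k\<in>{1..N}. gauss_weight N k * (f (gauss_node N k) - poly p (gauss_node N k))\<bar>
      \<le> (\<Sum>k\<in>{1..N}. gauss_weight N k * d)"
    using gauss_node_bounds[of _ N]
    by (intro order_trans[OF sum_abs] sum_mono)
       (auto simp: abs_mult gauss_weight_nonneg less_imp_le intro!: mult_left_mono le)
  also have "\<dots> = 2 * d"
    using sum_gauss_weight[OF N] by (simp flip: sum_distrib_right)
  finally have 2: "\<bar>(\<Sum>k\<in>{1..N}. gauss_weight N k * f (gauss_node N k)) - poly_integral p\<bar> \<le> 2 * d"
    by (simp add: gauss_quadrature_exact[OF p] right_diff_distrib sum_subtractf)
  from 1 2 show ?thesis by linarith
qed

section \<open>The integral representation of the logarithm\<close>

text \<open>The identity behind this is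
  \<open>(b + c)\<^sup>2 - (b - c)\<^sup>2 = 4 * b * c\<close>.\<close>

lemma lorentz3_rotated: "(a, b - c, b + c) \<in> lorentz3 \<longleftrightarrow> a\<^sup>2 \<le> 4 * b * c \<and> b + c \<ge> 0"
proof -
  have "sqrt (a\<^sup>2 + (b - c)\<^sup>2) \<le> b + c \<longleftrightarrow> a\<^sup>2 + (b - c)\<^sup>2 \<le> (b + c)\<^sup>2 \<and> b + c \<ge> 0"
    (is "?l \<longleftrightarrow> ?r")
  proof
    assume ?l
    moreover have "0 \<le> sqrt (a\<^sup>2 + (b - c)\<^sup>2)" by simp
    ultimately show ?r by (metis order_trans sqrt_le_D)
  next
    assume ?r
    then show ?l by (intro real_le_lsqrt) auto
  qed
  then show ?thesis
    by (simp add: lorentz3_def power2_eq_square algebra_simps)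
qed

lemma lorentz3_square: "(2 * r, x - 1, x + 1) \<in> lorentz3 \<longleftrightarrow> r\<^sup>2 \<le> x"
proof -
  have "r\<^sup>2 \<le> x \<Longrightarrow> 0 \<le> x" by (rule order_trans[OF zero_le_power2])
  then show ?thesis
    using lorentz3_rotated[of "2 * r" x 1] by (auto simp: power_mult_distrib)
qed

text \<open>The real values of \<^const>\<open>phi2\<close>, as a function of the root \<open>y = x powr (1 / 2 ^ s)\<close>.\<close>

definition psi :: "nat \<Rightarrow> real \<Rightarrow> real \<Rightarrow> real" where
  "psi s t y = 2 ^ s * (y - 1) / (2 + (t + 1) * (y - 1))"

text \<open>The denominator equals \<open>(1 - t) + (t + 1) * y\<close>.\<close>

lemma psi_denominator_pos:
  assumes "-1 < t" "t < 1" "0 \<le> (y::real)"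
  shows "2 + (t + 1) * (y - 1) > 0"
proof -
  have "(t + 1) * y \<ge> 0" using assms by simp
  then show ?thesis using assms by (simp add: algebra_simps)
qed

lemma divide_le_cross:
  fixes a b c d :: real
  assumes "b > 0" "d > 0" "a * d \<le> c * b"
  shows "a / b \<le> c / d"
  using assms by (simp add: divide_simps)

text \<open>After cross-multiplication the products of \<open>r - 1\<close> and \<open>y - 1\<close>
  cancel, and the difference of the two sides is \<open>2 * (y - r)\<close>.\<close>

lemma psi_mono:
  assumes "-1 < t" "t < 1" "0 \<le> r" "r \<le> y"
  shows "psi s t r \<le> psi s t y"
proof -
  have "(r - 1) / (2 + (t + 1) * (r - 1)) \<le> (y - 1) / (2 + (t + 1) * (y - 1))"
  proof (rule divide_le_cross)
    show "2 + (t + 1) * (r - 1) > 0" "2 + (t + 1) * (y - 1) > 0"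
      using assms by (intro psi_denominator_pos; simp)+
    show "(r - 1) * (2 + (t + 1) * (y - 1)) \<le> (y - 1) * (2 + (t + 1) * (r - 1))"
      using assms by (simp add: algebra_simps)
  qed
  then show ?thesis
    by (simp add: psi_def mult_left_mono flip: times_divide_eq_right)
qed

text \<open>In \<open>4 * g1 * g2\<close> minus the square of the first cone entry the terms in
  \<open>v\<^sup>2\<close> cancel, so under the sign conditions the cone constraint is a linear
  bound on \<open>v\<close>.\<close>

lemma psi_cone:
  assumes "-1 < t" "t < 1" "0 \<le> r"
    and g1: "g1 = 2 ^ s - (t + 1) * v" and g2: "g2 = r - 1 - 2 powi (1 - int s) * v"
  shows "(g1 \<ge> 0 \<and> g2 \<ge> 0 \<and>
      (v * sqrt (2 powi (3 - int s) * (t + 1)), g1 - g2, g1 + g2) \<in> lorentz3) \<longleftrightarrow>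
    (g1 \<ge> 0 \<and> g2 \<ge> 0 \<and> v \<le> psi s t r)"
proof -
  define c :: real where "c = 2 / 2 ^ s"
  have c: "2 powi (1 - int s) = c" "2 powi (3 - int s) = 4 * c" "c * 2 ^ s = 2"
    by (simp_all add: c_def power_int_diff)
  have sq: "(v * sqrt (4 * c * (t + 1)))\<^sup>2 = v\<^sup>2 * (4 * c * (t + 1))"
    using assms by (simp add: power_mult_distrib c_def)
  have "4 * g1 * g2 - v\<^sup>2 * (4 * c * (t + 1)) =
      4 * (2 ^ s * (r - 1) - (c * 2 ^ s) * v - (t + 1) * v * (r - 1))"
    unfolding g1 g2 c(1) by (simp add: algebra_simps power2_eq_square)
  also have "\<dots> = 4 * (2 ^ s * (r - 1) - v * (2 + (t + 1) * (r - 1)))"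
    unfolding c(3) by (simp add: algebra_simps)
  finally have "v\<^sup>2 * (4 * c * (t + 1)) \<le> 4 * g1 * g2 \<longleftrightarrow> v * (2 + (t + 1) * (r - 1)) \<le> 2 ^ s * (r - 1)"
    by (smt (verit))
  also have "\<dots> \<longleftrightarrow> v \<le> psi s t r"
    using psi_denominator_pos[OF assms(1-3)] by (simp add: psi_def le_divide_eq)
  finally show ?thesis
    unfolding lorentz3_rotated c(2) sq by auto
qed

text \<open>With \<open>D\<close> the denominator of \<open>psi\<close>, the two slacks are
  \<open>2 * 2 ^ s / D\<close> and \<open>(r - 1)\<^sup>2 * (t + 1) / D\<close>. Hence the largest
  value of \<open>v\<close> allowed by \<open>psi_cone\<close> also meets the sign
  conditions.\<close>

lemma psi_slack_nonneg:
  assumes "-1 < t" "t < 1" "0 \<le> r"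
  shows "2 ^ s - (t + 1) * psi s t r \<ge> 0" "r - 1 - 2 powi (1 - int s) * psi s t r \<ge> 0"
proof -
  let ?D = "2 + (t + 1) * (r - 1)"
  have D: "?D > 0" by (rule psi_denominator_pos[OF assms])
  have "2 ^ s - (t + 1) * psi s t r = 2 ^ s * 2 / ?D"
    using D by (simp add: psi_def divide_simps) (simp add: algebra_simps)
  then show "2 ^ s - (t + 1) * psi s t r \<ge> 0" using D by simp
  have "2 powi (1 - int s) * psi s t r = 2 * (r - 1) / ?D"
    by (simp add: psi_def power_int_diff)
  then have "r - 1 - 2 powi (1 - int s) * psi s t r = (r - 1)\<^sup>2 * (t + 1) / ?D"
    using D by (simp add: divide_simps) (simp add: algebra_simps power2_eq_square)
  then show "r - 1 - 2 powi (1 - int s) * psi s t r \<ge> 0" using D assms by simp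
qed

lemma powr_half_power_Suc:
  fixes x :: real
  shows "(x powr (1 / 2 ^ Suc i))\<^sup>2 = x powr (1 / 2 ^ i)"
proof -
  have "(1 / 2 ^ Suc i :: real) + 1 / 2 ^ Suc i = 1 / 2 ^ i" by simp
  then show ?thesis by (simp only: power2_eq_square powr_add[symmetric])
qed

text \<open>Each constraint bounds the square of one \<open>r\<close> by its predecessor, so one
  square root is taken per index, starting from \<open>x\<close>.\<close>

lemma iterated_roots_le:
  fixes x :: real and r :: "nat \<Rightarrow> real"
  assumes "x > 0" "\<forall>i\<in>{1..s}. r i \<ge> 0" "(r 1)\<^sup>2 \<le> x" "\<forall>i\<in>{1..s - 1}. (r (i + 1))\<^sup>2 \<le> r i"
    and "i \<in> {1..s}"
  shows "r i \<le> x powr (1 / 2 ^ i)"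
proof -
  have "Suc n \<le> s \<Longrightarrow> r (Suc n) \<le> x powr (1 / 2 ^ Suc n)" for n
  proof (induction n)
    case 0
    have "(x powr (1 / 2 ^ Suc 0))\<^sup>2 = x" using powr_half_power_Suc[of x 0] assms(1) by simp
    with assms(3) have "(r (Suc 0))\<^sup>2 \<le> (x powr (1 / 2 ^ Suc 0))\<^sup>2" by simp
    then show ?case by (rule power2_le_imp_le) simp
  next
    case (Suc n)
    have "(r (Suc (Suc n)))\<^sup>2 \<le> r (Suc n)" using assms(4) Suc.prems by force
    also have "\<dots> \<le> (x powr (1 / 2 ^ Suc (Suc n)))\<^sup>2"
      using Suc assms(1) by (subst powr_half_power_Suc) simp_all
    finally show ?case by (rule power2_le_imp_le) simp
  qed
  from this[of "i - 1"] show ?thesis using assms(5) by (simp del: power_Suc)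
qed


section \<open>The logarithm as an integral, and its polynomial approximation\<close>

text \<open>An antiderivative is \<open>2 ^ s\<close> times the logarithm of the denominator, which
  runs from \<open>2\<close> to \<open>2 * y\<close>; the difference is
  \<open>2 ^ s * ln y = ln x\<close>.\<close>

lemma ln_eq_integral_psi:
  assumes "x > 0"
  shows "((\<lambda>t. psi s t (x powr (1 / 2 ^ s))) has_integral ln x) {-1..1}"
proof -
  define y where "y = x powr (1 / 2 ^ s)"
  have y: "y > 0" using assms by (simp add: y_def)
  have pos: "2 + (t + 1) * (y - 1) > 0" if "t \<in> {-1..1}" for t
  \<comment> \<open>\<open>psi_denominator_pos\<close> covers the open interval only; at the ends
    the denominator is \<open>2\<close> or \<open>2 * y\<close>.\<close>
  proof (cases "t = -1 \<or> t = 1")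
    case False
    then show ?thesis using that y by (intro psi_denominator_pos) auto
  qed (use y in auto)
  let ?F = "\<lambda>t. 2 ^ s * ln (2 + (t + 1) * (y - 1))"
  have "((\<lambda>t. psi s t y) has_integral ?F 1 - ?F (-1)) {-1..1}"
  proof (rule fundamental_theorem_of_calculus)
    fix t :: real assume t: "t \<in> {-1..1}"
    have "(?F has_real_derivative psi s t y) (at t within {-1..1})"
      using pos[OF t] by (auto intro!: derivative_eq_intros simp: psi_def divide_simps)
    then show "(?F has_vector_derivative psi s t y) (at t within {-1..1})"
      by (simp add: has_real_derivative_iff_has_vector_derivative)
  qed simp
  moreover have "?F 1 - ?F (-1) = 2 ^ s * ln y"
  proof -
    have "2 + (1 + 1) * (y - 1) = 2 * y" by simp
    then show ?thesis using y by (simp add: ln_mult right_diff_distrib[symmetric] del: distrib_left_numeral)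
  qed
  moreover have "2 ^ s * ln y = ln x"
    using assms by (simp add: y_def ln_powr)
  ultimately show ?thesis by (simp add: y_def)
qed

text \<open>The remainder of the geometric series is exactly
  \<open>2 ^ s * b * (- (b * t)) ^ n / (1 + b * t)\<close>, and
  \<open>1 + b * t \<ge> 1 - \<bar>b\<bar>\<close>.\<close>

lemma psi_geometric_approx:
  assumes "y > 0" "t \<in> {-1..1}"
  defines "b \<equiv> (y - 1) / (y + 1)"
  shows "\<bar>psi s t y - poly (\<Sum>j<n. monom (2 ^ s * b * (- b) ^ j) j) t\<bar> \<le> 2 ^ s * \<bar>b\<bar> ^ (n + 1) / (1 - \<bar>b\<bar>)"
proof -
  have b: "\<bar>b\<bar> < 1" using assms(1) by (auto simp: b_def abs_less_iff divide_simps)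
  have bt: "\<bar>b * t\<bar> \<le> \<bar>b\<bar>" using assms(2) by (auto simp: abs_mult intro: mult_left_le)
  have pos: "1 - \<bar>b\<bar> \<le> 1 + b * t" "1 + b * t > 0" using b bt by linarith+
  have "2 + (t + 1) * (y - 1) = (y + 1) * (1 + b * t)"
    using assms(1) by (simp add: b_def field_simps)
  then have psi: "psi s t y = 2 ^ s * b / (1 + b * t)"
    by (simp add: psi_def b_def)
  have "poly (\<Sum>j<n. monom (2 ^ s * b * (- b) ^ j) j) t = 2 ^ s * b * (\<Sum>j<n. (- (b * t)) ^ j)"
  proof -
    have "(- b) ^ j * t ^ j = (- (b * t)) ^ j" for j
      by (simp flip: power_mult_distrib)
    then show ?thesis
      by (simp add: poly_sum poly_monom sum_distrib_left mult.assoc)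
  qed
  also have "(\<Sum>j<n. (- (b * t)) ^ j) = (1 - (- (b * t)) ^ n) / (1 + b * t)"
    using pos(2) by (subst sum_gp_strict) (auto simp: algebra_simps)
  finally have "psi s t y - poly (\<Sum>j<n. monom (2 ^ s * b * (- b) ^ j) j) t =
      2 ^ s * b * (- (b * t)) ^ n / (1 + b * t)"
    unfolding psi by (simp add: diff_divide_distrib algebra_simps)
  then have "\<bar>psi s t y - poly (\<Sum>j<n. monom (2 ^ s * b * (- b) ^ j) j) t\<bar> =
      2 ^ s * (\<bar>b\<bar> * \<bar>b * t\<bar> ^ n) / (1 + b * t)"
    using pos(2) by (simp add: abs_mult power_abs)
  also have "\<dots> \<le> 2 ^ s * (\<bar>b\<bar> * \<bar>b\<bar> ^ n) / (1 - \<bar>b\<bar>)"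
    using b bt pos by (intro frac_le mult_left_mono power_mono) auto
  finally show ?thesis by simp
qed

text \<open>In both cases the denominator is decreased, to \<open>y\<close> or to \<open>1\<close>,
  and then \<open>ln u \<le> u - 1\<close> applies with \<open>u = 1 / y\<close> or
  \<open>u = y\<close>.\<close>

lemma cayley_abs_le_ln:
  assumes "(y::real) > 0"
  shows "\<bar>(y - 1) / (y + 1)\<bar> \<le> \<bar>ln y\<bar>"
proof (cases "y \<ge> 1")
  case True
  have "(y - 1) / (y + 1) \<le> (y - 1) / y"
    using True by (intro frac_le) simp_all
  also have "\<dots> = 1 - 1 / y" using True by (simp add: field_simps)
  also have "\<dots> \<le> ln y"
    using ln_le_minus_one[of "1 / y"] True by (simp add: ln_div)
  finally show ?thesis using True by simp
next
  case False
  have "(1 - y) / (y + 1) \<le> (1 - y) / 1"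
    using False assms by (intro frac_le) simp_all
  also have "\<dots> \<le> - ln y"
    using ln_le_minus_one[of y] assms by simp
  finally show ?thesis using False assms by (simp add: abs_if divide_simps)
qed

section \<open>The bound on the Bernstein ellipse\<close>

text \<open>For \<open>y \<noteq> 1\<close> the pole of \<open>phi2\<close> in its complex argument
  is \<open>- (y + 1) / (y - 1)\<close>, of modulus at least \<open>rho M s\<close>, while the
  ellipse stays in the disc whose radius is its major semi-axis, which is smaller. The gap between
  the two radii is the denominator of \<open>Lbound\<close>.\<close>

lemma rho_and_bound:
  assumes M: "M > 1"
  shows "rho M s > 1" "0 < Lbound M s" "Lbound M s < \<infinity>"
    and "\<lbrakk>x \<in> {1 / M..M}; z = of_real (rho M s / 2) * exp (\<i> * of_real \<theta>)
                   + of_real (inverse (rho M s) / 2) * exp (- (\<i> * of_real \<theta>))\<rbrakk> \<Longrightarrow>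
               2 + (z + 1) * (of_real (x powr (1 / 2 ^ s)) - 1) \<noteq> 0 \<and>
               ereal (cmod (phi2 s z x)) \<le> Lbound M s"
proof -
  define m where "m = M powr (1 / 2 ^ s)"
  have m: "m > 1" using M by (simp add: m_def)
  have rho: "rho M s = (m + 1) / (m - 1)" by (simp add: rho_def m_def)
  show r1: "rho M s > 1" using m by (simp add: rho divide_simps)
  define d where "d = rho M s / 2 - inverse (rho M s) / 2"
  have d: "d > 0" using r1 by (simp add: d_def field_simps) (metis less_1_mult mult.commute)
  have L: "Lbound M s = ereal (2 ^ s / d)"
  proof -
    have "rho M s - rho M s / 2 - inverse (rho M s) / 2 = d" by (simp add: d_def)
    then show ?thesis using d by (simp add: Lbound_def flip: rho_def)
  qed
  show "0 < Lbound M s" "Lbound M s < \<infinity>" using d by (simp_all add: L)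
  assume x: "x \<in> {1 / M..M}" and z: "z = of_real (rho M s / 2) * exp (\<i> * of_real \<theta>)
                   + of_real (inverse (rho M s) / 2) * exp (- (\<i> * of_real \<theta>))"
  define y where "y = x powr (1 / 2 ^ s)"
  have x0: "x > 0" using x M by (auto intro: less_le_trans[of _ "1 / M"])
  have y0: "y > 0" using x0 by (simp add: y_def)
  have "(1 / M) powr (1 / 2 ^ s) \<le> y" unfolding y_def
    using x M by (intro powr_mono2) auto
  then have ylo: "1 / m \<le> y" using M by (simp add: m_def powr_divide)
  have yhi: "y \<le> m" unfolding y_def m_def using x x0 by (intro powr_mono2) auto
  \<comment> \<open>The pole has modulus at least \<open>rho M s\<close>; the extreme cases are
    \<open>y = m\<close> and \<open>y = 1 / m\<close>.\<close>
  have key: "rho M s * \<bar>y - 1\<bar> \<le> y + 1"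
  proof (cases "y \<ge> 1")
    case True
    have "(m + 1) * (y - 1) \<le> (y + 1) * (m - 1)" using yhi by (simp add: algebra_simps)
    then show ?thesis using True m by (simp add: rho divide_simps)
  next
    case False
    have "(m + 1) * (1 - y) \<le> (y + 1) * (m - 1)" using ylo m by (simp add: algebra_simps divide_simps)
    then show ?thesis using False m by (simp add: rho divide_simps)
  qed
  \<comment> \<open>\<open>rho M s - d\<close> is the major semi-axis
    \<open>(rho M s + inverse (rho M s)) / 2\<close>.\<close>
  have nz: "cmod z \<le> rho M s - d"
  proof -
    have "cmod z \<le> rho M s / 2 * cmod (exp (\<i> * of_real \<theta>)) + inverse (rho M s) / 2 * cmod (exp (- (\<i> * of_real \<theta>)))"
      unfolding z using r1 by (intro order_trans[OF norm_triangle_ineq]) (simp add: norm_mult norm_inverse)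
    then show ?thesis by (simp add: d_def)
  qed
  define D where "D = 2 + (z + 1) * (of_real y - 1)"
  have "D = of_real (y + 1) + z * of_real (y - 1)" by (simp add: D_def algebra_simps)
  then have "cmod D \<ge> (y + 1) - cmod z * \<bar>y - 1\<bar>"
    using norm_diff_ineq[of "of_real (y + 1) :: complex" "z * of_real (y - 1)"] y0
    by (simp add: norm_mult del: of_real_add of_real_diff)
  moreover have "cmod z * \<bar>y - 1\<bar> \<le> (rho M s - d) * \<bar>y - 1\<bar>"
    using nz by (intro mult_right_mono) auto
  ultimately have Dge: "cmod D \<ge> (y + 1 - rho M s * \<bar>y - 1\<bar>) + d * \<bar>y - 1\<bar>"
    by (simp add: algebra_simps)
  have Dpos: "cmod D > 0"
  \<comment> \<open>At \<open>y = 1\<close> there is no pole and \<open>D = 2\<close>; elsewhere the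
    gap \<open>d\<close> keeps \<open>D\<close> away from 0.\<close>
  proof (cases "y = 1")
    case False
    then have "d * \<bar>y - 1\<bar> > 0" using d by simp
    then show ?thesis using Dge key by linarith
  qed (simp add: D_def)
  have "cmod (phi2 s z x) = 2 ^ s * \<bar>y - 1\<bar> / cmod D"
    unfolding phi2_def y_def[symmetric] D_def[symmetric]
    using norm_of_real[of "y - 1", where 'a = complex]
    by (simp add: norm_divide norm_mult norm_power)
  also have "\<dots> \<le> 2 ^ s / d"
  proof -
    have "d * \<bar>y - 1\<bar> \<le> cmod D" using Dge key by linarith
    then show ?thesis using d Dpos by (simp add: divide_simps mult.commute)
  qed
  finally show "2 + (z + 1) * (of_real (x powr (1 / 2 ^ s)) - 1) \<noteq> 0 \<and>
               ereal (cmod (phi2 s z x)) \<le> Lbound M s"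
    using Dpos by (auto simp: L D_def y_def)
qed

section \<open>The second-order cone representation\<close>

definition gauss_log :: "nat \<Rightarrow> nat \<Rightarrow> real \<Rightarrow> real" where
  "gauss_log s N x = (\<Sum>k\<in>{1..N}. gauss_weight N k * psi s (gauss_node N k) (x powr (1 / 2 ^ s)))"

section \<open>Elimination of the auxiliary variables\<close>

text \<open>A feasible \<open>v k\<close> is at most \<open>psi\<close> at \<open>r s\<close>, and
  \<open>r s\<close> is at most the exact root, so monotonicity and nonnegative weights bound the
  sum. Conversely, the exact roots with \<open>v k\<close> equal to \<open>psi\<close> are feasible
  and attain this bound.\<close>

lemma Hhat_eq:
  assumes M: "M > 1" and s: "s \<ge> 1"
  shows "Hhat M s N = {(x, \<nu>). x \<in> {1 / M..M} \<and> \<nu> \<le> gauss_log s N x}"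
proof (intro equalityI subrelI)
  fix x \<nu> assume "(x, \<nu>) \<in> Hhat M s N"
  then obtain r v g1 g2 :: "nat \<Rightarrow> real" where x: "x \<in> {1 / M..M}"
    and sum: "(\<Sum>k\<in>{1..N}. gauss_weight N k * v k) \<ge> \<nu>"
    and r: "\<forall>i\<in>{1..s}. r i \<ge> 0" "(r 1)\<^sup>2 \<le> x" "\<forall>i\<in>{1..s - 1}. (r (i + 1))\<^sup>2 \<le> r i"
    and g: "\<forall>k\<in>{1..N}.
           g1 k = 2 ^ s - (gauss_node N k + 1) * v k \<and> g1 k \<ge> 0 \<and>
           g2 k = r s - 1 - 2 powi (1 - int s) * v k \<and> g2 k \<ge> 0 \<and>
           (v k * sqrt (2 powi (3 - int s) * (gauss_node N k + 1)), g1 k - g2 k, g1 k + g2 k)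
             \<in> lorentz3"
    unfolding Hhat_def lorentz3_square by blast
  have x0: "x > 0" using x M by (auto intro: less_le_trans[of _ "1 / M"])
  have rs: "0 \<le> r s" "r s \<le> x powr (1 / 2 ^ s)"
    using iterated_roots_le[OF x0 r, of s] r(1) s by auto
  have "v k \<le> psi s (gauss_node N k) (x powr (1 / 2 ^ s))" if k: "k \<in> {1..N}" for k
  proof -
    note b = gauss_node_bounds[OF k]
    have "v k \<le> psi s (gauss_node N k) (r s)"
      using psi_cone[OF b rs(1), of "g1 k" s "v k" "g2 k"] g k by blast
    also have "\<dots> \<le> psi s (gauss_node N k) (x powr (1 / 2 ^ s))"
      by (rule psi_mono[OF b rs])
    finally show ?thesis .
  qed
  then have "(\<Sum>k\<in>{1..N}. gauss_weight N k * v k) \<le> gauss_log s N x"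
    unfolding gauss_log_def by (intro sum_mono mult_left_mono gauss_weight_nonneg)
  with x sum show "(x, \<nu>) \<in> {(x, \<nu>). x \<in> {1 / M..M} \<and> \<nu> \<le> gauss_log s N x}"
    by auto
next
  fix x \<nu> assume "(x, \<nu>) \<in> {(x, \<nu>). x \<in> {1 / M..M} \<and> \<nu> \<le> gauss_log s N x}"
  then have x: "x \<in> {1 / M..M}" and \<nu>: "\<nu> \<le> gauss_log s N x" by auto
  have x0: "x > 0" using x M by (auto intro: less_le_trans[of _ "1 / M"])
  \<comment> \<open>These roots turn every root constraint into an equality; \<open>r 0 = x\<close>
    makes the first one an instance of the recursion.\<close>
  define r where "r i = x powr (1 / 2 ^ i)" for i :: nat
  define v where "v k = psi s (gauss_node N k) (r s)" for k
  have r0: "r i \<ge> 0" for i by (simp add: r_def)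
  have r1: "(r (Suc i))\<^sup>2 = r i" for i
    unfolding r_def by (rule powr_half_power_Suc)
  have r2: "(r 1)\<^sup>2 \<le> x" using r1[of 0] x0 by (simp add: r_def)
  have g: "2 ^ s - (gauss_node N k + 1) * v k \<ge> 0 \<and> r s - 1 - 2 powi (1 - int s) * v k \<ge> 0 \<and>
      (v k * sqrt (2 powi (3 - int s) * (gauss_node N k + 1)),
       2 ^ s - (gauss_node N k + 1) * v k - (r s - 1 - 2 powi (1 - int s) * v k),
       2 ^ s - (gauss_node N k + 1) * v k + (r s - 1 - 2 powi (1 - int s) * v k)) \<in> lorentz3"
    if k: "k \<in> {1..N}" for k
    unfolding psi_cone[OF gauss_node_bounds[OF k] r0 refl refl]
    using psi_slack_nonneg[OF gauss_node_bounds[OF k] r0] by (simp add: v_def)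
  show "(x, \<nu>) \<in> Hhat M s N"
    unfolding Hhat_def lorentz3_square mem_Collect_eq prod.case
  proof (intro conjI exI)
    show "x \<in> {1 / M..M}" by fact
    show "(\<Sum>k\<in>{1..N}. gauss_weight N k * v k) \<ge> \<nu>"
      using \<nu> by (simp add: gauss_log_def v_def r_def)
    show "\<forall>i\<in>{1..s}. r i \<ge> 0" using r0 by simp
    show "(r 1)\<^sup>2 \<le> x" by fact
    show "\<forall>i\<in>{1..s - 1}. (r (i + 1))\<^sup>2 \<le> r i" using r1 by simp
    show "\<forall>k\<in>{1..N}. 2 ^ s - (gauss_node N k + 1) * v k = 2 ^ s - (gauss_node N k + 1) * v k \<and>
        2 ^ s - (gauss_node N k + 1) * v k \<ge> 0 \<and>
        r s - 1 - 2 powi (1 - int s) * v k = r s - 1 - 2 powi (1 - int s) * v k \<and>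
        r s - 1 - 2 powi (1 - int s) * v k \<ge> 0 \<and>
      (v k * sqrt (2 powi (3 - int s) * (gauss_node N k + 1)),
       2 ^ s - (gauss_node N k + 1) * v k - (r s - 1 - 2 powi (1 - int s) * v k),
       2 ^ s - (gauss_node N k + 1) * v k + (r s - 1 - 2 powi (1 - int s) * v k)) \<in> lorentz3"
      using g by blast
  qed
qed

text \<open>Truncation after \<open>2 * N\<close> terms leaves degree at most
  \<open>2 * N - 1\<close>, within the range where the quadrature is exact. The 8 is the 4 of
  \<open>gauss_quadrature_error\<close> doubled by
  \<open>1 - \<bar>b\<bar> \<ge> 1 / 2\<close>.\<close>

lemma gauss_log_error:
  assumes N: "N \<ge> 1" and x: "x > 0" and q: "\<bar>ln x\<bar> \<le> 2 ^ s * q" "q \<le> 1 / 2"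
  shows "\<bar>ln x - gauss_log s N x\<bar> \<le> 8 * 2 ^ s * q ^ (2 * N + 1)"
proof -
  define y where "y = x powr (1 / 2 ^ s)"
  define b where "b = (y - 1) / (y + 1)"
  define p where "p = (\<Sum>j<2 * N. monom (2 ^ s * b * (- b) ^ j) j)"
  have y: "y > 0" using x by (simp add: y_def)
  have "\<bar>b\<bar> \<le> \<bar>ln y\<bar>"
    unfolding b_def by (rule cayley_abs_le_ln[OF y])
  also have "\<dots> = \<bar>ln x\<bar> / 2 ^ s"
    using x by (simp add: y_def ln_powr abs_mult)
  also have "\<dots> \<le> q"
    using q(1) by (simp add: divide_le_eq mult.commute)
  finally have b: "\<bar>b\<bar> \<le> q" .
  have deg: "degree p < 2 * N"
  proof -
    have "degree p \<le> 2 * N - 1" unfolding p_def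
      by (rule degree_sum_le) (auto intro: order_trans[OF degree_monom_le])
    then show ?thesis using N by simp
  qed
  have int: "(\<lambda>t. psi s t y) integrable_on {-1..1}" "integral {-1..1} (\<lambda>t. psi s t y) = ln x"
    using ln_eq_integral_psi[OF x, of s] by (auto simp: y_def integral_unique)
  have approx: "\<bar>psi s t y - poly p t\<bar> \<le> 2 ^ s * \<bar>b\<bar> ^ (2 * N + 1) / (1 - \<bar>b\<bar>)"
    if "t \<in> {-1..1}" for t
    unfolding p_def b_def by (rule psi_geometric_approx[OF y that])
  have "\<bar>ln x - gauss_log s N x\<bar> \<le> 4 * (2 ^ s * \<bar>b\<bar> ^ (2 * N + 1) / (1 - \<bar>b\<bar>))"
    using gauss_quadrature_error[OF N deg int(1) approx]
    unfolding int(2) gauss_log_def y_def[symmetric] .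
  also have "\<dots> \<le> 4 * (2 ^ s * q ^ (2 * N + 1) / (1 / 2))"
    using b q(2) by (intro mult_left_mono frac_le power_mono) auto
  finally show ?thesis by simp
qed

lemma Hhat_sandwich:
  assumes M: "M > 1" and s: "s \<ge> 1"
    and err: "\<And>x. x \<in> {1 / M..M} \<Longrightarrow> \<bar>ln x - gauss_log s N x\<bar> \<le> \<epsilon>"
  shows "hyp_log M (- \<epsilon>) \<subseteq> Hhat M s N" "Hhat M s N \<subseteq> hyp_log M \<epsilon>"
proof -
  have "ln x - gauss_log s N x \<le> \<epsilon>" "gauss_log s N x - ln x \<le> \<epsilon>" if "x \<in> {1 / M..M}" for x
    using err[OF that] by linarith+
  then show "hyp_log M (- \<epsilon>) \<subseteq> Hhat M s N" "Hhat M s N \<subseteq> hyp_log M \<epsilon>"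
    unfolding Hhat_eq[OF M s] hyp_log_def by (fastforce simp del: atLeastAtMost_iff)+
qed

section \<open>The cone system and its size\<close>

text \<open>An assignment packs \<open>x\<close>, \<open>\<nu>\<close> and the four quantified
  families into one function on \<open>hvar\<close>; satisfaction of the system then unfolds to the
  body of \<open>Hhat\<close>.\<close>

lemma soc_represents_Hhat:
  assumes s: "s \<ge> 1"
  shows "soc_represents (Hhat_system M s N) VarX VarNu (Hhat M s N)"
proof -
  have sat: "(\<forall>c\<in>set (Hhat_system M s N). satisfies y c) \<longleftrightarrow>
     y VarX \<in> {1 / M..M} \<and>
        (\<Sum>k\<in>{1..N}. gauss_weight N k * y (VarV k)) \<ge> y VarNu \<and>
        (\<forall>i\<in>{1..s}. y (VarR i) \<ge> 0) \<and>
        (2 * y (VarR 1), y VarX - 1, y VarX + 1) \<in> lorentz3 \<and>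
        (\<forall>i\<in>{1..s - 1}. (2 * y (VarR (i + 1)), y (VarR i) - 1, y (VarR i) + 1) \<in> lorentz3) \<and>
        (\<forall>k\<in>{1..N}.
           y (VarG1 k) = 2 ^ s - (gauss_node N k + 1) * y (VarV k) \<and> y (VarG1 k) \<ge> 0 \<and>
           y (VarG2 k) = y (VarR s) - 1 - 2 powi (1 - int s) * y (VarV k) \<and> y (VarG2 k) \<ge> 0 \<and>
           (y (VarV k) * sqrt (2 powi (3 - int s) * (gauss_node N k + 1)),
            y (VarG1 k) - y (VarG2 k), y (VarG1 k) + y (VarG2 k)) \<in> lorentz3)" for y
  proof -
    have "(\<Sum>(i, c)\<leftarrow>map (\<lambda>k. (VarV k, gauss_weight N k)) [1..<Suc N]. c * y i) =
        (\<Sum>k\<in>{1..N}. gauss_weight N k * y (VarV k))"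
      by (simp add: comp_def interv_sum_list_conv_sum_set_nat atLeastLessThanSuc_atLeastAtMost
          del: upt_Suc)
    then have sum: "eval_form y (map (\<lambda>k. (VarV k, gauss_weight N k)) [1..<Suc N] @ [(VarNu, -1)], 0)
        = (\<Sum>k\<in>{1..N}. gauss_weight N k * y (VarV k)) - y VarNu"
      by (simp add: eval_form_def del: upt_Suc)
    have sets: "set [1..<Suc N] = {1..N}" "set [1..<Suc s] = {1..s}" "set [1..<s] = {1..s - 1}"
      using s by auto
    have e1: "eval_form y ([(i, c)], d) = c * y i + d" for i c d
      by (simp add: eval_form_def)
    have e2: "eval_form y ([(i, c), (i', c')], d) = c * y i + c' * y i' + d" for i c d i' c'
      by (simp add: eval_form_def)
    have e3: "eval_form y ([(i, c), (i', c'), (i'', c'')], d) = c * y i + c' * y i' + c'' * y i'' + d"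
      for i c d i' c' i'' c''
      by (simp add: eval_form_def)
    show ?thesis
      unfolding Hhat_system_def set_append set_map set_concat sets list.set ball_Un UN_simps ball_UN
        Ball_image_comp ball_simps satisfies.simps sum
      by (auto simp: e1 e2 e3 algebra_simps)
  qed
  show ?thesis
    unfolding soc_represents_def
  proof (intro equalityI subrelI)
    fix x \<nu> assume "(x, \<nu>) \<in> Hhat M s N"
    then obtain r v g1 g2 :: "nat \<Rightarrow> real" where h: "x \<in> {1 / M..M}"
        "(\<Sum>k\<in>{1..N}. gauss_weight N k * v k) \<ge> \<nu> \<and>
        (\<forall>i\<in>{1..s}. r i \<ge> 0) \<and>
        (2 * r 1, x - 1, x + 1) \<in> lorentz3 \<and>
        (\<forall>i\<in>{1..s - 1}. (2 * r (i + 1), r i - 1, r i + 1) \<in> lorentz3) \<and>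
        (\<forall>k\<in>{1..N}.
           g1 k = 2 ^ s - (gauss_node N k + 1) * v k \<and> g1 k \<ge> 0 \<and>
           g2 k = r s - 1 - 2 powi (1 - int s) * v k \<and> g2 k \<ge> 0 \<and>
           (v k * sqrt (2 powi (3 - int s) * (gauss_node N k + 1)), g1 k - g2 k, g1 k + g2 k)
             \<in> lorentz3)"
      unfolding Hhat_def mem_Collect_eq prod.case by (elim conjE exE) blast
    define y where "y = (\<lambda>w. case w of VarX \<Rightarrow> x | VarNu \<Rightarrow> \<nu> | VarR i \<Rightarrow> r i
        | VarV k \<Rightarrow> v k | VarG1 k \<Rightarrow> g1 k | VarG2 k \<Rightarrow> g2 k)"
    have "\<forall>c\<in>set (Hhat_system M s N). satisfies y c"
      unfolding sat y_def hvar.case using h by blast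
    moreover have "x = y VarX" "\<nu> = y VarNu" by (simp_all add: y_def)
    ultimately show "(x, \<nu>) \<in> {(y VarX, y VarNu) | y. \<forall>c\<in>set (Hhat_system M s N). satisfies y c}"
      by blast
  next
    fix x \<nu> assume "(x, \<nu>) \<in> {(y VarX, y VarNu) | y. \<forall>c\<in>set (Hhat_system M s N). satisfies y c}"
    then obtain y where y: "x = y VarX" "\<nu> = y VarNu" "\<forall>c\<in>set (Hhat_system M s N). satisfies y c"
      by blast
    note h = y(3)[unfolded sat]
    show "(x, \<nu>) \<in> Hhat M s N"
      unfolding y(1,2) Hhat_def mem_Collect_eq prod.case
      by (rule conjI[OF conjunct1[OF h]], rule exI[of _ "\<lambda>k. y (VarR k)"],
          rule exI[of _ "\<lambda>k. y (VarV k)"], rule exI[of _ "\<lambda>k. y (VarG1 k)"],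
          rule exI[of _ "\<lambda>k. y (VarG2 k)"], rule conjunct2[OF h])
  qed
qed

text \<open>Two bounds on \<open>x\<close> and the quadrature inequality give 3; the roots
  contribute \<open>s\<close> sign conditions and \<open>s\<close> cones; each node contributes
  5.\<close>

lemma num_constraints_Hhat_system:
  assumes "s \<ge> 1"
  shows "num_constraints (Hhat_system M s N) = 3 + 2 * s + 5 * N"
  using assms by (simp add: num_constraints_def Hhat_system_def length_concat comp_def sum_list_triv
      del: upt_Suc)

text \<open>Besides \<open>VarX\<close> and \<open>VarNu\<close> there is one variable per root and
  three per node; an upper bound is enough for the asymptotics.\<close>

lemma num_variables_Hhat_system:
  assumes s: "s \<ge> 1"
  shows "num_variables (Hhat_system M s N) \<le> 2 + s + 3 * N"
proof -
  let ?V = "{VarX, VarNu} \<union> VarR ` {1..s} \<union> VarV ` {1..N} \<union> VarG1 ` {1..N} \<union> VarG2 ` {1..N}"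
  have "\<Union> (constraint_vars ` set (Hhat_system M s N)) \<subseteq> ?V"
    using s by (auto simp: Hhat_system_def form_vars_def image_iff simp del: upt_Suc)
  then have "num_variables (Hhat_system M s N) \<le> card ?V"
    unfolding num_variables_def by (intro card_mono) auto
  also have "\<dots> \<le> card {VarX, VarNu} + card (VarR ` {1..s}) + card (VarV ` {1..N})
      + card (VarG1 ` {1..N}) + card (VarG2 ` {1..N})"
    by (intro order_trans[OF card_Un_le] add_right_mono order_refl)
  also have "\<dots> \<le> 2 + s + N + N + N"
    using card_image_le[of "{1..s}" VarR] card_image_le[of "{1..N}" VarV]
      card_image_le[of "{1..N}" VarG1] card_image_le[of "{1..N}" VarG2]
    by simp
  finally show ?thesis by simp
qed

section \<open>The number of quadrature points\<close>

text \<open>With \<open>A = log_part M\<close>, \<open>K = eps_part \<epsilon>\<close> and \<open>s = N = A + K\<close> one has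
  \<open>\<bar>b\<bar> \<le> max 1 (ln M) / 2 ^ N \<le> 2 ^ A / 2 ^ N = 1 / 2 ^ K\<close>, so the error is at most
  \<open>2 ^ (3 + N) / 2 ^ (K * (2 * N + 1)) \<le> 1 / 2 ^ (K * K) \<le> \<epsilon>\<close>.\<close>

definition log_part :: "real \<Rightarrow> nat" where
  "log_part M = nat \<lceil>log 2 (max 1 (ln M))\<rceil>"

text \<open>A square root suffices because the error decays like \<open>1 / 2 ^ (K * K)\<close>. The
  offset 3 pays for the factor \<open>2 ^ 3\<close> in the error, and \<open>max 0\<close> covers
  \<open>\<epsilon> > 1\<close>.\<close>

definition eps_part :: "real \<Rightarrow> nat" where
  "eps_part \<epsilon> = 3 + nat \<lceil>sqrt (max 0 (log 2 (1 / \<epsilon>)))\<rceil>"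

definition num_points :: "real \<Rightarrow> real \<Rightarrow> nat" where
  "num_points M \<epsilon> = log_part M + eps_part \<epsilon>"

lemma num_points_ge_1: "num_points M \<epsilon> \<ge> 1"
  by (simp add: num_points_def eps_part_def)

lemma num_points_error:
  assumes M: "M > 1" and e: "\<epsilon> > 0" and x: "x \<in> {1 / M..M}"
  shows "\<bar>ln x - gauss_log (num_points M \<epsilon>) (num_points M \<epsilon>) x\<bar> \<le> \<epsilon>"
proof -
  define A K N where "A = log_part M" and "K = eps_part \<epsilon>" and "N = num_points M \<epsilon>"
  have N: "N = A + K" "N \<ge> 1" "K \<ge> 3"
    by (simp_all add: A_def K_def N_def num_points_def eps_part_def)
  define q :: real where "q = 1 / 2 ^ K"
  have x0: "x > 0" using x M by (auto intro: less_le_trans[of _ "1 / M"])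
  have "ln (1 / M) \<le> ln x" "ln x \<le> ln M"
    using x x0 M by (subst ln_le_cancel_iff; simp)+
  then have "\<bar>ln x\<bar> \<le> ln M" using M by (simp add: ln_div)
  also have "\<dots> \<le> 2 ^ A"
  proof -
    have "log 2 (max 1 (ln M)) \<le> real A"
      unfolding A_def log_part_def by linarith
    then have "2 powr log 2 (max 1 (ln M)) \<le> 2 powr real A" by (intro powr_mono) auto
    then show ?thesis by (simp add: powr_realpow)
  qed
  also have "\<dots> = 2 ^ N * q" by (simp add: N(1) q_def power_add)
  finally have lnx: "\<bar>ln x\<bar> \<le> 2 ^ N * q" .
  have q: "q \<le> 1 / 2"
    using power_increasing[of 1 K "2::real"] N(3) by (simp add: q_def divide_simps)
  have "\<bar>ln x - gauss_log N N x\<bar> \<le> 8 * 2 ^ N * q ^ (2 * N + 1)"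
    by (rule gauss_log_error[OF N(2) x0 lnx q])
  also have "\<dots> = 2 ^ (3 + N) / 2 ^ (K * (2 * N + 1))"
    by (simp add: q_def power_divide power_add power_mult[symmetric] algebra_simps)
  also have "\<dots> \<le> 1 / 2 ^ (K * K)"
  proof -
    \<comment> \<open>In \<open>K * (2 * N + 1)\<close> one copy of \<open>K * N\<close> absorbs
      \<open>N\<close>, the other absorbs \<open>K * K\<close>, and the last \<open>K\<close>
      absorbs the 3.\<close>
    have "N \<le> K * N" using N(3) by simp
    moreover have "K * K \<le> K * N" using N(1) by simp
    moreover have "K * (2 * N + 1) = K * N + K * N + K" by (simp add: algebra_simps)
    ultimately have "3 + N + K * K \<le> K * (2 * N + 1)" using N(3) by linarith
    then have "2 ^ (3 + N + K * K) \<le> (2 ^ (K * (2 * N + 1)) :: real)"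
      by (intro power_increasing) auto
    then show ?thesis by (simp add: divide_simps power_add mult.commute)
  qed
  also have "\<dots> \<le> \<epsilon>"
  proof -
    have "sqrt (max 0 (log 2 (1 / \<epsilon>))) \<le> real K"
      unfolding K_def eps_part_def by linarith
    then have "max 0 (log 2 (1 / \<epsilon>)) \<le> (real K)\<^sup>2"
      by (rule sqrt_le_D)
    then have "log 2 (1 / \<epsilon>) \<le> real (K * K)" by (simp add: power2_eq_square)
    then have "2 powr log 2 (1 / \<epsilon>) \<le> 2 powr real (K * K)" by (intro powr_mono) auto
    then have "1 / \<epsilon> \<le> 2 ^ (K * K)" using e by (simp add: powr_realpow del: of_nat_mult)
    then show ?thesis using e by (simp add: divide_simps mult.commute)
  qed
  finally show ?thesis by (simp add: N_def)
qed

section \<open>Asymptotic growth\<close>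

text \<open>Passing from base 2 to natural logarithms costs at most a factor 2, since
  \<open>ln 2 \<ge> 1 / 2\<close>. The constant 5 is the offset 3 of \<open>eps_part\<close> plus
  one for each of the two ceilings.\<close>

lemma num_points_le:
  assumes M: "M > 1" and e: "\<epsilon> > 0" and T: "ln M + ln (1 / \<epsilon>) \<ge> 0"
  shows "real (num_points M \<epsilon>) \<le> 5 + 2 * max 0 (ln (ln M)) + 2 * sqrt (ln M + ln (1 / \<epsilon>))"
proof -
  have l2: "ln 2 \<ge> (1 / 2 :: real)"
    using ln_le_minus_one[of "1 / 2 :: real"] by (simp add: ln_div)
  have log2: "log 2 z \<le> 2 * ln z" if "ln z \<ge> 0" for z :: real
  proof -
    have "ln z * 1 \<le> ln z * (2 * ln 2)" using that l2 by (intro mult_left_mono) auto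
    then show ?thesis using l2 by (simp add: log_def divide_simps)
  qed
  have lM: "ln M > 0" using M by simp
  have "ln (max 1 (ln M)) = max 0 (ln (ln M))"
    using lM by (auto simp: max_def)
  then have "log 2 (max 1 (ln M)) \<le> 2 * max 0 (ln (ln M))"
    using log2[of "max 1 (ln M)"] by simp
  then have 1: "real (log_part M) \<le> 1 + 2 * max 0 (ln (ln M))"
    unfolding log_part_def by linarith
  \<comment> \<open>The factor 2 from \<open>log2\<close> is relaxed to 4, whose square root is
    2.\<close>
  have "max 0 (log 2 (1 / \<epsilon>)) \<le> 4 * (ln M + ln (1 / \<epsilon>))"
  proof (cases "ln (1 / \<epsilon>) \<ge> 0")
    case True
    then show ?thesis using log2[of "1 / \<epsilon>"] lM by simp
  next
    case False
    then have "log 2 (1 / \<epsilon>) \<le> 0" using l2 by (simp add: log_def divide_le_0_iff)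
    then show ?thesis using T by simp
  qed
  then have "sqrt (max 0 (log 2 (1 / \<epsilon>))) \<le> sqrt (4 * (ln M + ln (1 / \<epsilon>)))"
    by (rule real_sqrt_le_mono)
  then have "sqrt (max 0 (log 2 (1 / \<epsilon>))) \<le> 2 * sqrt (ln M + ln (1 / \<epsilon>))"
    by (simp only: real_sqrt_mult real_sqrt_four)
  then have 2: "real (eps_part \<epsilon>) \<le> 4 + 2 * sqrt (ln M + ln (1 / \<epsilon>))"
    unfolding eps_part_def using T by (simp add: algebra_simps) linarith
  from 1 2 show ?thesis by (simp add: num_points_def)
qed

text \<open>For \<open>M\<close> near \<open>M0\<close> the term \<open>ln (ln M)\<close> may be
  negative, but never below \<open>- c\<close>. Far out in the filter, half of the square root
  outweighs both \<open>c\<close> and the additive constant of \<open>num_points_le\<close>.\<close>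

lemma eventually_growth_num_points_le:
  assumes M0: "M0 > 1" and e0: "e0 > 0"
  shows "eventually (\<lambda>(M, \<epsilon>). real (num_points M \<epsilon>) \<le> 5 * rate (M, \<epsilon>)) (growth M0 e0)"
proof -
  define c where "c = \<bar>ln (ln M0)\<bar>"
  \<comment> \<open>One of \<open>ln M\<close> and \<open>ln (1 / \<epsilon>)\<close> reaches
    \<open>ln R\<close> and the other is at least \<open>- \<bar>ln e0\<bar>\<close>, so their sum
    is at least \<open>(2 * c + 2)\<^sup>2\<close>.\<close>
  define R where "R = exp ((2 * c + 2)\<^sup>2 + \<bar>ln e0\<bar>)"
  have "real (num_points M \<epsilon>) \<le> 5 * rate (M, \<epsilon>)"
    if R: "max M (1 / \<epsilon>) \<ge> R" and M: "M \<ge> M0" and e: "0 < \<epsilon>" "\<epsilon> \<le> e0" for M \<epsilon>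
  proof -
    let ?T = "ln M + ln (1 / \<epsilon>)"
    have "ln (1 / \<epsilon>) \<ge> - \<bar>ln e0\<bar>"
    proof -
      have "ln \<epsilon> \<le> ln e0" using e e0 by simp
      also have "\<dots> \<le> \<bar>ln e0\<bar>" by (rule abs_ge_self)
      finally show ?thesis using e by (simp add: ln_div)
    qed
    moreover have "ln M > 0" using M M0 by simp
    moreover have "ln M \<ge> ln R \<or> ln (1 / \<epsilon>) \<ge> ln R"
    proof -
      have "R > 0" by (simp add: R_def)
      then show ?thesis using R e M M0 unfolding le_max_iff_disj by (metis ln_mono less_le_trans)
    qed
    moreover have "ln R = (2 * c + 2)\<^sup>2 + \<bar>ln e0\<bar>" by (simp add: R_def)
    ultimately have T: "?T \<ge> (2 * c + 2)\<^sup>2" by linarith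
    then have T0: "?T \<ge> 0" by (rule order_trans[OF zero_le_power2])
    have sT: "sqrt ?T \<ge> 2 * c + 2" by (rule real_le_rsqrt[OF T])
    have "ln (ln M) \<ge> ln (ln M0)" using M M0 by simp
    then have "ln (ln M) \<ge> max 0 (ln (ln M)) - c" by (auto simp: c_def)
    \<comment> \<open>Half of \<open>sqrt ?T\<close> is at least \<open>c + 1\<close>: it cancels
      the loss \<open>c\<close> and leaves 1, which after multiplication by 5 covers the constant
      5.\<close>
    with sT have "rate (M, \<epsilon>) \<ge> max 0 (ln (ln M)) + sqrt ?T / 2 + 1"
      by (simp add: rate_def)
    moreover have "real (num_points M \<epsilon>) \<le> 5 + 2 * max 0 (ln (ln M)) + 2 * sqrt ?T"
      using num_points_le[of M \<epsilon>] M M0 e T0 by simp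
    moreover have "sqrt ?T \<ge> 0" "max 0 (ln (ln M)) \<ge> 0" using T0 by simp_all
    ultimately show ?thesis by (smt (verit) field_sum_of_halves)
  qed
  then show ?thesis
    unfolding growth_def eventually_inf_principal eventually_filtercomap
    by (intro exI[of _ "\<lambda>w. w \<ge> R"]) (auto simp: eventually_ge_at_top)
qed

lemma bigo_rate:
  assumes "M0 > 1" "e0 > 0" and f: "\<And>M \<epsilon>. f M \<epsilon> \<le> C * num_points M \<epsilon>"
  shows "(\<lambda>(M, \<epsilon>). real (f M \<epsilon>)) \<in> O[growth M0 e0](rate)"
proof (rule bigoI)
  have "real (f M \<epsilon>) \<le> real C * 5 * \<bar>rate (M, \<epsilon>)\<bar>" if "real (num_points M \<epsilon>) \<le> 5 * rate (M, \<epsilon>)" for M \<epsilon>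
  proof -
    have "real (f M \<epsilon>) \<le> real C * real (num_points M \<epsilon>)"
      using f[of M \<epsilon>] by (metis of_nat_le_iff of_nat_mult)
    also have "\<dots> \<le> real C * (5 * \<bar>rate (M, \<epsilon>)\<bar>)"
      using that by (intro mult_left_mono) auto
    finally show ?thesis by simp
  qed
  then show "eventually (\<lambda>w. norm (case w of (M, \<epsilon>) \<Rightarrow> real (f M \<epsilon>)) \<le> real C * 5 * norm (rate w)) (growth M0 e0)"
    using eventually_growth_num_points_le[OF assms(1,2)] by (auto elim!: eventually_mono)
qed

theorem corollary2:
  shows "(\<forall>M>1. \<forall>s\<ge>1.
            rho M s > 1 \<and> 0 < Lbound M s \<and> Lbound M s < \<infinity> \<and>
            (\<forall>x\<in>{1 / M..M}. \<forall>\<theta>\<in>{0..2 * pi}. \<forall>z.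
               z = of_real (rho M s / 2) * exp (\<i> * of_real \<theta>)
                   + of_real (inverse (rho M s) / 2) * exp (- (\<i> * of_real \<theta>)) \<longrightarrow>
               2 + (z + 1) * (of_real (x powr (1 / 2 ^ s)) - 1) \<noteq> 0 \<and>
               ereal (cmod (phi2 s z x)) \<le> Lbound M s)) \<and>
         (\<exists>N :: real \<Rightarrow> real \<Rightarrow> nat.
            (\<forall>M>1. \<forall>\<epsilon>>0.
               N M \<epsilon> \<ge> 1 \<and>
               hyp_log M (- \<epsilon>) \<subseteq> Hhat M (N M \<epsilon>) (N M \<epsilon>) \<and>
               Hhat M (N M \<epsilon>) (N M \<epsilon>) \<subseteq> hyp_log M \<epsilon> \<and>
               soc_represents (Hhat_system M (N M \<epsilon>) (N M \<epsilon>)) VarX VarNu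
                 (Hhat M (N M \<epsilon>) (N M \<epsilon>))) \<and>
            (\<forall>M0>1. \<forall>e0>0.
               (\<lambda>(M, \<epsilon>). real (N M \<epsilon>)) \<in> O[growth M0 e0](rate) \<and>
               (\<lambda>(M, \<epsilon>). real (num_variables (Hhat_system M (N M \<epsilon>) (N M \<epsilon>))))
                  \<in> O[growth M0 e0](rate) \<and>
               (\<lambda>(M, \<epsilon>). real (num_constraints (Hhat_system M (N M \<epsilon>) (N M \<epsilon>))))
                  \<in> O[growth M0 e0](rate)))"
proof (intro conjI allI impI ballI exI[of _ num_points])
  fix M :: real and s :: nat assume M: "M > 1"
  show "rho M s > 1" "0 < Lbound M s" "Lbound M s < \<infinity>"
    by (fact rho_and_bound[OF M])+
  fix x \<theta> z assume "x \<in> {1 / M..M}" "z = of_real (rho M s / 2) * exp (\<i> * of_real \<theta>)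
      + of_real (inverse (rho M s) / 2) * exp (- (\<i> * of_real \<theta>))"
  note * = rho_and_bound(4)[OF M this]
  show "2 + (z + 1) * (of_real (x powr (1 / 2 ^ s)) - 1) \<noteq> 0"
    by (rule conjunct1[OF *])
  show "ereal (cmod (phi2 s z x)) \<le> Lbound M s"
    by (rule conjunct2[OF *])
next
  fix M \<epsilon> :: real assume M: "M > 1" and e: "\<epsilon> > 0"
  let ?N = "num_points M \<epsilon>"
  show N: "?N \<ge> 1" by (rule num_points_ge_1)
  show "hyp_log M (- \<epsilon>) \<subseteq> Hhat M ?N ?N" "Hhat M ?N ?N \<subseteq> hyp_log M \<epsilon>"
    by (rule Hhat_sandwich[OF M N num_points_error[OF M e]]; assumption)+
  show "soc_represents (Hhat_system M ?N ?N) VarX VarNu (Hhat M ?N ?N)"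
    by (rule soc_represents_Hhat[OF N])
next
  fix M0 e0 :: real assume M0: "M0 > 1" and e0: "e0 > 0"
  show "(\<lambda>(M, \<epsilon>). real (num_points M \<epsilon>)) \<in> O[growth M0 e0](rate)"
    by (rule bigo_rate[OF M0 e0, of _ 1]) simp
  show "(\<lambda>(M, \<epsilon>). real (num_variables (Hhat_system M (num_points M \<epsilon>) (num_points M \<epsilon>))))
      \<in> O[growth M0 e0](rate)"
  \<comment> \<open>With \<open>s = N\<close> the bound is \<open>2 + 4 * N\<close>, and
    \<open>N \<ge> 1\<close> gives \<open>6 * N\<close>.\<close>
  proof (rule bigo_rate[OF M0 e0, of _ 6])
    fix M \<epsilon> :: real
    show "num_variables (Hhat_system M (num_points M \<epsilon>) (num_points M \<epsilon>)) \<le> 6 * num_points M \<epsilon>"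
      using num_variables_Hhat_system[OF num_points_ge_1[of M \<epsilon>], of M "num_points M \<epsilon>"]
        num_points_ge_1[of M \<epsilon>] by linarith
  qed
  show "(\<lambda>(M, \<epsilon>). real (num_constraints (Hhat_system M (num_points M \<epsilon>) (num_points M \<epsilon>))))
      \<in> O[growth M0 e0](rate)"
  \<comment> \<open>With \<open>s = N\<close> the count is \<open>3 + 7 * N\<close>, at most
    \<open>10 * N\<close>.\<close>
  proof (rule bigo_rate[OF M0 e0, of _ 10])
    fix M \<epsilon> :: real
    show "num_constraints (Hhat_system M (num_points M \<epsilon>) (num_points M \<epsilon>)) \<le> 10 * num_points M \<epsilon>"
      using num_constraints_Hhat_system[OF num_points_ge_1[of M \<epsilon>], of M "num_points M \<epsilon>"]
        num_points_ge_1[of M \<epsilon>] by linarith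
  qed
qed

end
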